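(* Let $(\Omega,\mathcal{F}_\infty,\{\mathcal{F}_t\}_{t\in\mathcal{T}})$ be a filtered measurable space, where $\mathcal{T}=[0,\infty)$ or $\mathcal{T}=\{0,1,2,\ldots\}$, let $P$ and $\widetilde P$ be probability measures on $(\Omega,\mathcal{F}_\infty)$, and let $\tau:\Omega\to\mathcal{T}\cup\{\infty\}$ be an $\mathcal{F}_t$-stopping time. Assume there exist $\eta_0,K\in[0,\infty)$ such that $$R(\widetilde P|_{\mathcal{F}_{\tau\wedge n}}\|P|_{\mathcal{F}_{\tau\wedge n}})\leq \eta_0+K E_{\widetilde{P}}[\tau\wedge n]$$ for all positive integers $n$. Then $$-\inf_{c>0}\left\{(c+K)^{-1}\left(\Lambda_{P}^{\tau}(- c)+ \eta_0\right)\right\} \leq E_{\widetilde{P}}[\tau] \leq\inf_{\lambda>K}\left\{ (\lambda-K)^{-1}\left(\Lambda_{P}^{\tau}( \lambda)+ \eta_0\right)\right\}.$$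
   Context: For a stopping time $\sigma$, $\mathcal{F}_\sigma=\{A\in\mathcal{F}_\infty:\ A\cap\{\sigma\leq t\}\in\mathcal{F}_t \text{ for all } t\in\mathcal{T}\}$, and $\tau\wedge n=\min\{\tau,n\}$. $Q|_{\mathcal{G}}$ is the restriction of $Q$ to the sub sigma-algebra $\mathcal{G}$. $\Lambda_P^\tau(c)=\log E_P[e^{c\tau}]$ (natural logarithm, with the continuous extensions of $\exp$ to the extended reals and of $\log$ to $[0,\infty]$). The relative entropy is $R(\widetilde P\|P)=E_{\widetilde P}[\log(d\widetilde P/dP)]$ if $\widetilde P\ll P$, and $+\infty$ otherwise. *)

theory Defs
  imports "HOL-Probability.Probability"
begin

text \<open>
  The time set is a set of reals and stopping times take values in \<open>[0, \<infinity>]\<close>. The library's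
  \<^const>\<open>stopping_time\<close> and \<^locale>\<open>filtration\<close> use one type both for the index set and for the
  values, so neither a time set such as \<open>\<nat>\<close> inside the reals nor the value \<open>\<infinity>\<close> fits directly.
  Only the underlying sigma-algebra of \<open>M\<close> (which plays the role of \<open>F\<^sub>\<infinity>\<close>) and of each \<open>F t\<close> matters.
\<close>

definition filtered_measurable_space ::
  "'a measure \<Rightarrow> real set \<Rightarrow> (real \<Rightarrow> 'a measure) \<Rightarrow> bool" where
  "filtered_measurable_space M T F \<longleftrightarrow>
     (\<forall>t\<in>T. subalgebra M (F t)) \<and>
     (\<forall>s\<in>T. \<forall>t\<in>T. s \<le> t \<longrightarrow> sets (F s) \<subseteq> sets (F t))"

definition ext_stopping_time ::
  "'a measure \<Rightarrow> real set \<Rightarrow> (real \<Rightarrow> 'a measure) \<Rightarrow> ('a \<Rightarrow> ennreal) \<Rightarrow> bool" where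
  "ext_stopping_time M T F \<tau> \<longleftrightarrow>
     (\<forall>\<omega>\<in>space M. \<tau> \<omega> \<in> ennreal ` T \<union> {\<infinity>}) \<and>
     (\<forall>t\<in>T. {\<omega>\<in>space M. \<tau> \<omega> \<le> ennreal t} \<in> sets (F t))"

definition stopped_algebra ::
  "'a measure \<Rightarrow> real set \<Rightarrow> (real \<Rightarrow> 'a measure) \<Rightarrow> ('a \<Rightarrow> ennreal) \<Rightarrow> 'a measure" where
  "stopped_algebra M T F \<sigma> =
     sigma (space M) {A\<in>sets M. \<forall>t\<in>T. A \<inter> {\<omega>\<in>space M. \<sigma> \<omega> \<le> ennreal t} \<in> sets (F t)}"

lemma sets_stopped_algebra:
  assumes F: "filtered_measurable_space M T F" and \<sigma>: "ext_stopping_time M T F \<sigma>"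
  shows "sets (stopped_algebra M T F \<sigma>) =
    {A\<in>sets M. \<forall>t\<in>T. A \<inter> {\<omega>\<in>space M. \<sigma> \<omega> \<le> ennreal t} \<in> sets (F t)}" (is "_ = ?S")
proof -
  have "sigma_algebra (space M) ?S"
    unfolding sigma_algebra_iff2
  proof (intro conjI ballI allI impI)
    show "?S \<subseteq> Pow (space M)"
      using sets.sets_into_space by blast
    show "{} \<in> ?S" by simp
  next
    fix A assume A: "A \<in> ?S"
    have "(space M - A) \<inter> {\<omega>\<in>space M. \<sigma> \<omega> \<le> ennreal t} \<in> sets (F t)" if t: "t \<in> T" for t
    proof -
      have "{\<omega>\<in>space M. \<sigma> \<omega> \<le> ennreal t} - A \<inter> {\<omega>\<in>space M. \<sigma> \<omega> \<le> ennreal t} \<in> sets (F t)"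
        using A \<sigma> t by (intro sets.Diff) (auto simp: ext_stopping_time_def)
      also have "{\<omega>\<in>space M. \<sigma> \<omega> \<le> ennreal t} - A \<inter> {\<omega>\<in>space M. \<sigma> \<omega> \<le> ennreal t} =
          (space M - A) \<inter> {\<omega>\<in>space M. \<sigma> \<omega> \<le> ennreal t}"
        by auto
      finally show ?thesis .
    qed
    then show "space M - A \<in> ?S" using A by auto
  next
    fix A :: "nat \<Rightarrow> 'a set" assume A: "range A \<subseteq> ?S"
    have "(\<Union>i. A i) \<inter> {\<omega>\<in>space M. \<sigma> \<omega> \<le> ennreal t} \<in> sets (F t)" if t: "t \<in> T" for t
    proof -
      have "(\<Union>i. A i \<inter> {\<omega>\<in>space M. \<sigma> \<omega> \<le> ennreal t}) \<in> sets (F t)"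
        using A t by (intro sets.countable_UN) auto
      then show ?thesis by (simp only: UN_extend_simps)
    qed
    moreover have "(\<Union>i. A i) \<in> sets M"
      using A by (intro sets.countable_UN) auto
    ultimately show "(\<Union>i. A i) \<in> ?S" by auto
  qed
  then show ?thesis
    unfolding stopped_algebra_def by (rule sigma_algebra.sets_measure_of_eq)
qed

definition exp_ext :: "ereal \<Rightarrow> ennreal" where
  "exp_ext x = (if x = -\<infinity> then 0 else if x = \<infinity> then \<infinity> else ennreal (exp (real_of_ereal x)))"

definition ln_ext :: "ennreal \<Rightarrow> ereal" where
  "ln_ext x = (if x = 0 then -\<infinity> else if x = \<infinity> then \<infinity> else ereal (ln (enn2real x)))"

text \<open>
  \<^const>\<open>e2ennreal\<close> truncates negative values to 0, so the two terms below are the integrals of the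
  positive and of the negative part. The value is the usual one whenever one of them is finite.
\<close>

definition ext_expectation :: "'a measure \<Rightarrow> ('a \<Rightarrow> ereal) \<Rightarrow> ereal" where
  "ext_expectation Q f =
     enn2ereal (\<integral>\<^sup>+x. e2ennreal (f x) \<partial>Q) - enn2ereal (\<integral>\<^sup>+x. e2ennreal (- f x) \<partial>Q)"

text \<open>
  \<^const>\<open>KL_divergence\<close> is real-valued and equals 0 when the log-density is not integrable, so it
  cannot express an infinite relative entropy.
  \<open>absolutely_continuous P Q\<close> means that \<open>Q\<close> is absolutely continuous with respect to \<open>P\<close>, and
  \<open>RN_deriv P Q\<close> is \<open>dQ/dP\<close>. Under absolute continuity of probability measures the negative part
  of the integrand is \<open>Q\<close>-integrable.
\<close>

definition relative_entropy :: "'a measure \<Rightarrow> 'a measure \<Rightarrow> ereal" where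
  "relative_entropy Q P =
     (if absolutely_continuous P Q then ext_expectation Q (\<lambda>x. ln_ext (RN_deriv P Q x)) else \<infinity>)"

definition cumulant :: "'a measure \<Rightarrow> ('a \<Rightarrow> ennreal) \<Rightarrow> real \<Rightarrow> ereal" where
  "cumulant P \<tau> c = ln_ext (\<integral>\<^sup>+\<omega>. exp_ext (ereal c * enn2ereal (\<tau> \<omega>)) \<partial>P)"

end

theory Submission
  imports Defs
begin

text \<open>
  Everything rests on one half of the Gibbs (Donsker--Varadhan) variational principle: for bounded
  measurable \<open>f\<close>,
  \<open>E\<^sub>Q[f] - ln E\<^sub>P[exp f] \<le> R(Q \<parallel> P)\<close>.
  The truncated time \<open>X\<^sub>n = min \<tau> n\<close> is bounded and measurable with respect to its own stopped
  sigma-algebra, so the inequality may be used there with \<open>f = c X\<^sub>n\<close>, where the entropy of the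
  restricted measures is at most \<open>\<eta>\<^sub>0 + K E\<^sub>Q[X\<^sub>n]\<close>. This gives, for every real \<open>c\<close>,
  \<open>(c - K) E\<^sub>Q[X\<^sub>n] \<le> ln E\<^sub>P[exp (c X\<^sub>n)] + \<eta>\<^sub>0\<close>.
  Choosing \<open>c > K\<close> and dividing by \<open>c - K\<close> bounds \<open>E\<^sub>Q[X\<^sub>n]\<close> from above, replacing \<open>c\<close> by \<open>-c < 0\<close>
  and dividing by \<open>c + K\<close> bounds it from below. All quantities here are finite reals; infinite
  ones appear only in the limit \<open>n \<rightarrow> \<infinity>\<close>.

  In the upper bound \<open>exp (c X\<^sub>n) \<le> exp (c \<tau>)\<close>, and \<open>E\<^sub>Q[X\<^sub>n]\<close> increases to \<open>E\<^sub>Q[\<tau>]\<close> by monotone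
  convergence (\<open>nn_integral_le_of_truncations\<close>). In the lower bound \<open>exp (- c X\<^sub>n)\<close> decreases to
  \<open>exp (- c \<tau>)\<close>, and dominated convergence passes to the limit
  (\<open>exp_ext_nn_integral_ge_of_truncations\<close>).
\<close>

section \<open>Stopping times and their sigma-algebras\<close>

lemma ext_stopping_time_min:
  assumes F: "filtered_measurable_space M T F" and \<tau>: "ext_stopping_time M T F \<tau>"
    and r: "r \<in> T"
  shows "ext_stopping_time M T F (\<lambda>\<omega>. min (\<tau> \<omega>) (ennreal r))"
  unfolding ext_stopping_time_def
proof (intro conjI ballI)
  fix \<omega> assume "\<omega> \<in> space M"
  then show "min (\<tau> \<omega>) (ennreal r) \<in> ennreal ` T \<union> {\<infinity>}"
    using \<tau> r by (auto simp: ext_stopping_time_def min_def)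
next
  fix t assume t: "t \<in> T"
  show "{\<omega>\<in>space M. min (\<tau> \<omega>) (ennreal r) \<le> ennreal t} \<in> sets (F t)"
  proof (cases "ennreal r \<le> ennreal t")
    case True
    then have "{\<omega>\<in>space M. min (\<tau> \<omega>) (ennreal r) \<le> ennreal t} = space (F t)"
      using F t by (auto simp: filtered_measurable_space_def subalgebra_def min_le_iff_disj)
    then show ?thesis by simp
  next
    case False
    then have "{\<omega>\<in>space M. min (\<tau> \<omega>) (ennreal r) \<le> ennreal t} = {\<omega>\<in>space M. \<tau> \<omega> \<le> ennreal t}"
      by (auto simp: min_le_iff_disj)
    then show ?thesis using \<tau> t by (simp add: ext_stopping_time_def)
  qed
qed

lemma subalgebra_stopped_algebra:
  assumes F: "filtered_measurable_space M T F" and \<sigma>: "ext_stopping_time M T F \<sigma>"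
  shows "subalgebra M (stopped_algebra M T F \<sigma>)"
proof -
  have "space (stopped_algebra M T F \<sigma>) = space M"
    unfolding stopped_algebra_def by (rule space_measure_of) (auto dest: sets.sets_into_space)
  then show ?thesis
    by (auto simp: subalgebra_def sets_stopped_algebra[OF F \<sigma>])
qed

text \<open>
  A level set \<open>{\<sigma> \<le> s}\<close> with \<open>s\<close> outside the time set equals \<open>{\<sigma> \<le> r}\<close> for the last time \<open>r \<le> s\<close>,
  so it is already known at time \<open>r\<close>: take \<open>r = s\<close> in continuous and \<open>r = \<lfloor>s\<rfloor>\<close> in discrete time.
\<close>

lemma ext_stopping_time_measurable:
  assumes T: "T = {0..} \<or> T = \<nat>"
    and F: "filtered_measurable_space M T F" and \<sigma>: "ext_stopping_time M T F \<sigma>"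
  shows "\<sigma> \<in> borel_measurable (stopped_algebra M T F \<sigma>)"
proof (rule borel_measurableI_le)
  fix a :: ennreal
  have sp: "space (stopped_algebra M T F \<sigma>) = space M"
    using subalgebra_stopped_algebra[OF F \<sigma>] by (simp add: subalgebra_def)
  have last_time: "\<exists>r\<in>T. r \<le> s \<and> {\<omega>\<in>space M. \<sigma> \<omega> \<le> ennreal s} = {\<omega>\<in>space M. \<sigma> \<omega> \<le> ennreal r}"
    if s: "0 \<le> s" for s
  proof -
    obtain r where r: "r \<in> T" "r \<le> s" "\<And>u. u \<in> T \<Longrightarrow> u \<le> s \<Longrightarrow> u \<le> r"
    proof (cases "T = {0..}")
      case True
      then show ?thesis using that[of s] s by auto
    next
      case False
      then have [simp]: "T = \<nat>" using T by auto
      show ?thesis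
      proof (rule that[of "real (nat \<lfloor>s\<rfloor>)"])
        fix u assume "u \<in> T" "u \<le> s"
        then obtain k :: nat where "u = real k" "real k \<le> s" by (auto elim: Nats_cases)
        then show "u \<le> real (nat \<lfloor>s\<rfloor>)" using le_nat_floor of_nat_le_iff by metis
      next
        show "real (nat \<lfloor>s\<rfloor>) \<in> T" by (simp del: of_nat_nat)
      qed (use s in auto)
    qed
    have "\<sigma> \<omega> \<le> ennreal r" if "\<omega> \<in> space M" "\<sigma> \<omega> \<le> ennreal s" for \<omega>
    proof -
      have "\<sigma> \<omega> \<in> ennreal ` T" using \<sigma> that by (auto simp: ext_stopping_time_def top_unique)
      then obtain u where u: "u \<in> T" "\<sigma> \<omega> = ennreal u" by auto
      then have "u \<le> s" using that s by (auto simp: ennreal_le_iff)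
      then show ?thesis using r u by (simp add: ennreal_leI)
    qed
    moreover have "\<sigma> \<omega> \<le> ennreal s" if "\<sigma> \<omega> \<le> ennreal r" for \<omega>
      using that r(2) by (meson ennreal_leI order_trans)
    ultimately have "{\<omega>\<in>space M. \<sigma> \<omega> \<le> ennreal s} = {\<omega>\<in>space M. \<sigma> \<omega> \<le> ennreal r}" by blast
    then show ?thesis using r(1,2) by blast
  qed
  have known: "{\<omega>\<in>space M. \<sigma> \<omega> \<le> ennreal s} \<in> sets (F t)" if "0 \<le> s" "s \<le> t" "t \<in> T" for s t
  proof -
    obtain r where r: "r \<in> T" "r \<le> s"
        "{\<omega>\<in>space M. \<sigma> \<omega> \<le> ennreal s} = {\<omega>\<in>space M. \<sigma> \<omega> \<le> ennreal r}"
      using last_time[OF \<open>0 \<le> s\<close>] by blast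
    have "{\<omega>\<in>space M. \<sigma> \<omega> \<le> ennreal r} \<in> sets (F r)"
      using \<sigma> r(1) by (simp add: ext_stopping_time_def)
    moreover have "sets (F r) \<subseteq> sets (F t)"
      using F r that unfolding filtered_measurable_space_def by (meson order_trans)
    ultimately show ?thesis using r(3) by auto
  qed
  have "{\<omega>\<in>space M. \<sigma> \<omega> \<le> a} \<in> sets M"
  proof (cases a)
    case (real s)
    obtain r where r: "r \<in> T" "{\<omega>\<in>space M. \<sigma> \<omega> \<le> ennreal s} = {\<omega>\<in>space M. \<sigma> \<omega> \<le> ennreal r}"
      using last_time real by blast
    then have "{\<omega>\<in>space M. \<sigma> \<omega> \<le> ennreal s} \<in> sets (F r)"
      using \<sigma> by (simp add: ext_stopping_time_def)
    then show ?thesis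
      using F r(1) real by (auto simp: filtered_measurable_space_def subalgebra_def)
  qed simp
  moreover have "{\<omega>\<in>space M. \<sigma> \<omega> \<le> a} \<inter> {\<omega>\<in>space M. \<sigma> \<omega> \<le> ennreal t} \<in> sets (F t)"
    if t: "t \<in> T" for t
  proof -
    have t0: "0 \<le> t" using T t by (auto elim: Nats_cases)
    have "min a (ennreal t) < top" by (simp add: min_less_iff_disj)
    then obtain s where s: "0 \<le> s" "min a (ennreal t) = ennreal s"
      by (cases "min a (ennreal t)") auto
    have "ennreal s \<le> ennreal t" using s(2) by (metis min.cobounded2)
    then have "s \<le> t" using t0 by (simp add: ennreal_le_iff)
    moreover have "{\<omega>\<in>space M. \<sigma> \<omega> \<le> a} \<inter> {\<omega>\<in>space M. \<sigma> \<omega> \<le> ennreal t} =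
        {\<omega>\<in>space M. \<sigma> \<omega> \<le> ennreal s}"
      by (auto simp flip: s(2))
    ultimately show ?thesis using known s(1) t by auto
  qed
  ultimately show "{\<omega>\<in>space (stopped_algebra M T F \<sigma>). \<sigma> \<omega> \<le> a} \<in> sets (stopped_algebra M T F \<sigma>)"
    by (simp add: sets_stopped_algebra[OF F \<sigma>] sp)
qed

section \<open>Extended logarithm and expectation\<close>

lemma ln_ext_mono: "x \<le> y \<Longrightarrow> ln_ext x \<le> ln_ext y"
  by (cases x; cases y) (auto simp: ln_ext_def ennreal_le_iff top_unique)

lemma ln_ext_ennreal: "0 < x \<Longrightarrow> ln_ext (ennreal x) = ereal (ln x)"
  by (simp add: ln_ext_def)

text \<open>
  Raising the function raises its positive part and lowers its negative part, and subtraction of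
  extended reals is monotone in this sense even where it reads \<open>\<infinity> - \<infinity>\<close> (which is \<open>\<infinity>\<close>).
\<close>

lemma ext_expectation_mono_AE:
  assumes "AE x in Q. g x \<le> h x"
  shows "ext_expectation Q g \<le> ext_expectation Q h"
proof -
  have "(\<integral>\<^sup>+x. e2ennreal (g x) \<partial>Q) \<le> (\<integral>\<^sup>+x. e2ennreal (h x) \<partial>Q)"
    using assms by (intro nn_integral_mono_AE) (auto intro: e2ennreal_mono)
  moreover have "(\<integral>\<^sup>+x. e2ennreal (- h x) \<partial>Q) \<le> (\<integral>\<^sup>+x. e2ennreal (- g x) \<partial>Q)"
    using assms by (intro nn_integral_mono_AE) (auto elim!: eventually_mono intro!: e2ennreal_mono)
  ultimately show ?thesis
    unfolding ext_expectation_def by (intro ereal_minus_mono) (auto simp: less_eq_ennreal.rep_eq)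
qed

lemma ext_expectation_ereal:
  fixes g :: "'a \<Rightarrow> real"
  assumes g: "integrable Q g"
  shows "ext_expectation Q (\<lambda>x. ereal (g x)) = ereal (\<integral>x. g x \<partial>Q)"
proof -
  obtain r q where rq: "0 \<le> r" "0 \<le> q" "(\<integral>\<^sup>+x. ennreal (g x) \<partial>Q) = ennreal r"
      "(\<integral>\<^sup>+x. ennreal (- g x) \<partial>Q) = ennreal q" "integral\<^sup>L Q g = r - q"
    using integrableE[OF g] by metis
  have "\<And>x. e2ennreal (ereal x) = ennreal x" by (simp add: ennreal.abs_eq e2ennreal_def max.commute)
  then show ?thesis
    using rq by (simp add: ext_expectation_def)
qed

section \<open>The Gibbs variational inequality\<close>

text \<open>
  Let \<open>D = dQ/dP\<close> and \<open>Z = E\<^sub>P[exp f]\<close>. Applying \<open>ln y \<le> y - 1\<close> to \<open>y = exp f / (Z D)\<close>, the ratio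
  of the density of the tilted measure to that of \<open>Q\<close>, gives
  \<open>ln D \<ge> f - ln Z + 1 - exp f / (Z D)\<close> outside a \<open>Q\<close>-null set. The right-hand side is
  \<open>Q\<close>-integrable with mean at least \<open>E\<^sub>Q[f] - ln Z\<close>, because
  \<open>E\<^sub>Q[exp f / (Z D)] \<le> E\<^sub>P[exp f / Z] = 1\<close>. An integrable lower bound for \<open>ln D\<close> is enough to
  compare the expectations, also when \<open>R(Q \<parallel> P) = \<infinity>\<close>.
\<close>

lemma gibbs_variational_le_relative_entropy:
  fixes f :: "'a \<Rightarrow> real"
  assumes "prob_space P" "prob_space Q" and sets_eq: "sets Q = sets P"
    and f[measurable]: "f \<in> borel_measurable P" and bdd: "\<And>x. x \<in> space P \<Longrightarrow> \<bar>f x\<bar> \<le> B"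
  shows "ereal ((\<integral>x. f x \<partial>Q) - ln (\<integral>x. exp (f x) \<partial>P)) \<le> relative_entropy Q P"
proof (cases "absolutely_continuous P Q")
  case True
  interpret P: prob_space P by fact
  interpret Q: prob_space Q by fact
  define D where "D = RN_deriv P Q"
  have D[measurable]: "D \<in> borel_measurable P" unfolding D_def by simp
  have dens: "density P D = Q"
    unfolding D_def by (rule P.density_RN_deriv[OF True sets_eq])
  have fQ[measurable]: "f \<in> borel_measurable Q" and DQ[measurable]: "D \<in> borel_measurable Q"
    using f D by (simp_all add: measurable_cong_sets[OF sets_eq refl])
  have spQ: "space Q = space P" using sets_eq by (rule sets_eq_imp_space_eq)
  have D_top: "AE x in Q. D x \<noteq> \<infinity>"
  proof -
    have "AE x in P. D x \<noteq> \<infinity>"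
      unfolding D_def by (rule P.RN_deriv_finite[OF _ True sets_eq]) unfold_locales
    then show ?thesis
      using True sets_eq by (rule_tac absolutely_continuous_AE) auto
  qed
  have D_0: "AE x in Q. D x \<noteq> 0"
    by (subst dens[symmetric], subst AE_density) auto
  define Z where "Z = (\<integral>x. exp (f x) \<partial>P)"
  have intP: "integrable P (\<lambda>x. exp (f x))"
    by (rule P.integrable_const_bound[where B = "exp B"]) (use bdd in \<open>auto simp: abs_le_iff\<close>)
  have intQ: "integrable Q f"
    by (rule Q.integrable_const_bound[where B = B]) (use bdd spQ in auto)
  have "exp (- B) \<le> Z"
    unfolding Z_def using intP
    by (intro P.integral_ge_const) (use bdd in \<open>force simp: abs_le_iff\<close>)+
  then have Z: "0 < Z" by (meson exp_gt_zero less_le_trans)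
  define w where "w x = exp (f x) / Z * enn2real (inverse (D x))" for x
  have w[measurable]: "w \<in> borel_measurable Q" unfolding w_def by measurable
  \<comment> \<open>only \<open>\<le>\<close>, because the density may vanish on a set of positive \<open>P\<close>-measure\<close>
  have w_le: "(\<integral>\<^sup>+x. ennreal (w x) \<partial>Q) \<le> 1"
  proof -
    have "(\<integral>\<^sup>+x. ennreal (w x) \<partial>Q) = (\<integral>\<^sup>+x. D x * ennreal (w x) \<partial>P)"
      unfolding dens[symmetric] w_def by (intro nn_integral_density) measurable
    also have "\<dots> \<le> (\<integral>\<^sup>+x. ennreal (exp (f x) / Z) \<partial>P)"
    proof (rule nn_integral_mono)
      fix x
      have "D x * ennreal (w x) = ennreal (exp (f x) / Z) * (D x * ennreal (enn2real (inverse (D x))))"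
        using Z unfolding w_def by (subst ennreal_mult) (simp_all add: mult_ac)
      also have "D x * ennreal (enn2real (inverse (D x))) \<le> 1"
      proof (cases "D x")
        case (real d)
        then show ?thesis
          by (cases "d = 0") (auto simp: inverse_ennreal simp flip: ennreal_mult)
      qed simp
      then have "ennreal (exp (f x) / Z) * (D x * ennreal (enn2real (inverse (D x)))) \<le> ennreal (exp (f x) / Z) * 1"
        by (rule mult_left_mono) simp
      finally show "D x * ennreal (w x) \<le> ennreal (exp (f x) / Z)" by simp
    qed
    also have "\<dots> = ennreal (\<integral>x. exp (f x) / Z \<partial>P)"
      using intP Z by (intro nn_integral_eq_integral) auto
    also have "\<dots> = 1" using Z by (simp add: Z_def)
    finally show ?thesis .
  qed
  have w0: "0 \<le> w x" for x using Z by (simp add: w_def)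
  have intw: "integrable Q w"
    using w_le w0 by (intro integrableI_nonneg) (auto intro: le_less_trans)
  have "ennreal (\<integral>x. w x \<partial>Q) \<le> 1"
    using w_le nn_integral_eq_integral[OF intw] w0 by simp
  then have w_le1: "(\<integral>x. w x \<partial>Q) \<le> 1" by (simp add: ennreal_le_1)
  define g where "g x = f x - ln Z + 1 - w x" for x
  have "(\<integral>x. f x \<partial>Q) - ln Z \<le> (\<integral>x. g x \<partial>Q)"
    unfolding g_def using intQ intw w_le1 by (simp add: Q.prob_space)
  moreover have "integrable Q g" unfolding g_def using intQ intw by simp
  moreover have "AE x in Q. ereal (g x) \<le> ln_ext (D x)"
    using D_top D_0
  proof eventually_elim
    case (elim x)
    then obtain d where d: "0 < d" "D x = ennreal d"
      by (cases "D x") (auto simp: less_le)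
    have "w x = exp (f x) / Z / d"
      using d by (simp add: w_def inverse_ennreal field_simps)
    moreover have "ln (exp (f x) / Z / d) \<le> exp (f x) / Z / d - 1"
      using d Z by (intro ln_le_minus_one) auto
    moreover have "ln (exp (f x) / Z / d) = f x - ln Z - ln d"
      using d Z by (simp add: ln_div ln_mult)
    ultimately show ?case using d by (simp add: g_def ln_ext_ennreal)
  qed
  ultimately have "ereal ((\<integral>x. f x \<partial>Q) - ln Z) \<le> ext_expectation Q (\<lambda>x. ln_ext (D x))"
    using ext_expectation_mono_AE[of "\<lambda>x. ereal (g x)" "\<lambda>x. ln_ext (D x)" Q]
    by (metis ext_expectation_ereal ereal_less_eq(3) order_trans)
  then show ?thesis using True by (simp add: relative_entropy_def Z_def D_def)
qed (simp add: relative_entropy_def)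

lemma gibbs_variational_le_relative_entropy_restr:
  fixes f :: "'a \<Rightarrow> real"
  assumes P: "prob_space P" and Q: "prob_space Q" and "subalgebra P G" "subalgebra Q G"
    and f: "f \<in> borel_measurable G" and bdd: "\<And>x. x \<in> space G \<Longrightarrow> \<bar>f x\<bar> \<le> B"
  shows "ereal ((\<integral>x. f x \<partial>Q) - ln (\<integral>x. exp (f x) \<partial>P))
    \<le> relative_entropy (restr_to_subalg Q G) (restr_to_subalg P G)"
proof -
  have "ereal ((\<integral>x. f x \<partial>restr_to_subalg Q G) - ln (\<integral>x. exp (f x) \<partial>restr_to_subalg P G))
      \<le> relative_entropy (restr_to_subalg Q G) (restr_to_subalg P G)"
  proof (rule gibbs_variational_le_relative_entropy)
    show "f \<in> borel_measurable (restr_to_subalg P G)"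
      using f assms measurable_in_subalg' measurable_cong_sets[OF sets_restr_to_subalg refl] by blast
  qed (use assms in \<open>auto simp: sets_restr_to_subalg space_restr_to_subalg subalgebra_def
        intro: prob_space_restr_to_subalg\<close>)
  then show ?thesis
    using assms by (simp add: integral_subalgebra2)
qed

section \<open>Truncation of the stopping time\<close>

lemma enn2real_min_of_nat:
  "ennreal (enn2real (min x (of_nat n))) = min x (of_nat n)" for x :: ennreal
  by (rule ennreal_enn2real) (simp add: min_less_iff_disj of_nat_less_top)

lemma enn2real_min_of_nat_le: "enn2real (min x (of_nat n)) \<le> real n" for x :: ennreal
  by (metis enn2real_mono enn2real_of_nat ennreal_of_nat_eq_real_of_nat ennreal_less_top min.cobounded2)

lemma SUP_min_of_nat: "(SUP n. min x (of_nat n)) = x" for x :: ennreal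
  by (simp add: ennreal_SUP_of_nat_eq_top flip: inf_min inf_SUP)

lemma nn_integral_le_of_truncations:
  assumes [measurable]: "f \<in> borel_measurable Q"
    and le: "\<And>n. 0 < n \<Longrightarrow> (\<integral>\<^sup>+x. min (f x) (of_nat n) \<partial>Q) \<le> C"
  shows "(\<integral>\<^sup>+x. f x \<partial>Q) \<le> C"
proof -
  have "(\<integral>\<^sup>+x. f x \<partial>Q) = (\<integral>\<^sup>+x. (SUP n. min (f x) (of_nat n)) \<partial>Q)"
    by (simp add: SUP_min_of_nat)
  also have "\<dots> = (SUP n. \<integral>\<^sup>+x. min (f x) (of_nat n) \<partial>Q)"
    by (intro nn_integral_monotone_convergence_SUP)
      (auto simp: incseq_def le_fun_def intro!: min.coboundedI2)
  also have "\<dots> \<le> C"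
  proof (rule SUP_least)
    fix n :: nat
    show "(\<integral>\<^sup>+x. min (f x) (of_nat n) \<partial>Q) \<le> C"
      by (cases "n = 0") (use le in auto)
  qed
  finally show ?thesis .
qed

lemma exp_truncation_le_exp_ext:
  assumes "0 \<le> l"
  shows "ennreal (exp (l * enn2real (min x (of_nat n)))) \<le> exp_ext (ereal l * enn2ereal x)"
proof (cases x)
  case (real r)
  have "enn2real (min x (of_nat n)) \<le> r"
    using real by (metis enn2real_ennreal enn2real_mono ennreal_less_top min.cobounded1)
  then show ?thesis
    using real assms by (auto simp: exp_ext_def intro!: ennreal_leI mult_left_mono)
next
  case top
  then show ?thesis
    using assms by (cases "l = 0") (auto simp: exp_ext_def zero_ereal_def[symmetric])
qed

lemma tendsto_exp_truncation:
  assumes "0 < c"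
  shows "(\<lambda>n. ennreal (exp (- c * enn2real (min x (of_nat n))))) \<longlonglongrightarrow> exp_ext (ereal (- c) * enn2ereal x)"
proof (cases x)
  case (real r)
  obtain N :: nat where N: "r \<le> real N" using real_arch_simple by blast
  have "min x (of_nat n) = x" if "N \<le> n" for n
    using N that real by (auto simp: min_def ennreal_of_nat_eq_real_of_nat ennreal_le_iff)
  then have "\<forall>\<^sub>F n in sequentially. ennreal (exp (- c * enn2real (min x (of_nat n))))
      = exp_ext (ereal (- c) * enn2ereal x)"
    using real by (auto simp: eventually_sequentially exp_ext_def intro!: exI[of _ N])
  then show ?thesis by (rule tendsto_eventually)
next
  case top
  have "(\<lambda>n. exp (- c * real n)) \<longlonglongrightarrow> 0"
    using assms by real_asymp
  then have "(\<lambda>n. ennreal (exp (- c * real n))) \<longlonglongrightarrow> ennreal 0"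
    by (rule tendsto_ennrealI)
  then show ?thesis
    using top assms by (simp add: exp_ext_def)
qed

text \<open>
  The integrands decrease in \<open>n\<close> and are dominated by \<open>1\<close>. Their limit also captures the event
  \<open>\<tau> = \<infinity>\<close>, where \<open>exp (- c n)\<close> tends to \<open>0 = exp (- \<infinity>)\<close>. A positive \<open>b\<close> therefore implies
  that \<open>\<tau>\<close> is finite with positive probability, that is, that the cumulant at \<open>- c\<close> is not \<open>- \<infinity>\<close>.
\<close>

lemma exp_ext_nn_integral_ge_of_truncations:
  assumes "prob_space P" and [measurable]: "\<tau> \<in> borel_measurable P" and c: "0 < c"
    and ge: "\<And>n. 0 < n \<Longrightarrow> b \<le> (\<integral>x. exp (- c * enn2real (min (\<tau> x) (of_nat n))) \<partial>P)"
  shows "ennreal b \<le> (\<integral>\<^sup>+x. exp_ext (ereal (- c) * enn2ereal (\<tau> x)) \<partial>P)"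
proof -
  interpret prob_space P by fact
  let ?h = "\<lambda>n x. exp (- c * enn2real (min (\<tau> x) (of_nat n)))"
  have le1: "?h n x \<le> 1" for n x using c by simp
  have lim: "(\<lambda>n. \<integral>\<^sup>+x. ennreal (?h n x) \<partial>P) \<longlonglongrightarrow>
      (\<integral>\<^sup>+x. exp_ext (ereal (- c) * enn2ereal (\<tau> x)) \<partial>P)"
  proof (rule nn_integral_dominated_convergence[where w = "\<lambda>_. 1"])
    show "(\<lambda>x. exp_ext (ereal (- c) * enn2ereal (\<tau> x))) \<in> borel_measurable P"
      unfolding exp_ext_def by measurable
    show "AE x in P. ennreal (?h n x) \<le> 1" for n
      using le1[of _ n] by (auto simp: ennreal_le_1 simp del: exp_le_one_iff)
    show "AE x in P. (\<lambda>n. ennreal (?h n x)) \<longlonglongrightarrow> exp_ext (ereal (- c) * enn2ereal (\<tau> x))"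
      using tendsto_exp_truncation[OF c] by simp
  qed (auto simp: emeasure_space_1)
  have "ennreal b \<le> (\<integral>\<^sup>+x. ennreal (?h n x) \<partial>P)" if "0 < n" for n
  proof -
    have "integrable P (?h n)"
      using le1[of _ n] by (intro integrable_const_bound[where B = 1]) (auto simp del: exp_le_one_iff)
    then show ?thesis
      using ge[OF that] by (simp add: nn_integral_eq_integral ennreal_leI)
  qed
  then show ?thesis
    by (intro LIMSEQ_le_const[OF lim]) (auto intro!: exI[of _ 1])
qed

section \<open>Bounds on the expected stopping time\<close>

theorem corollary4:
  fixes M P Q :: "'a measure" and T :: "real set" and F :: "real \<Rightarrow> 'a measure"
    and \<tau> :: "'a \<Rightarrow> ennreal" and \<eta>\<^sub>0 K :: real
  assumes "T = {0..} \<or> T = \<nat>"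
    and "filtered_measurable_space M T F"
    and "prob_space P" and "sets P = sets M"
    and "prob_space Q" and "sets Q = sets M"
    and "ext_stopping_time M T F \<tau>"
    and "0 \<le> \<eta>\<^sub>0" and "0 \<le> K"
    and "\<And>n::nat. 0 < n \<Longrightarrow>
      relative_entropy
          (restr_to_subalg Q (stopped_algebra M T F (\<lambda>\<omega>. min (\<tau> \<omega>) (of_nat n))))
          (restr_to_subalg P (stopped_algebra M T F (\<lambda>\<omega>. min (\<tau> \<omega>) (of_nat n))))
        \<le> ereal \<eta>\<^sub>0 + ereal K * enn2ereal (\<integral>\<^sup>+\<omega>. min (\<tau> \<omega>) (of_nat n) \<partial>Q)"
  shows "- (INF c\<in>{0<..}. ereal (inverse (c + K)) * (cumulant P \<tau> (- c) + ereal \<eta>\<^sub>0))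
           \<le> enn2ereal (\<integral>\<^sup>+\<omega>. \<tau> \<omega> \<partial>Q) \<and>
         enn2ereal (\<integral>\<^sup>+\<omega>. \<tau> \<omega> \<partial>Q)
           \<le> (INF l\<in>{K<..}. ereal (inverse (l - K)) * (cumulant P \<tau> l + ereal \<eta>\<^sub>0))"
proof -
  note T = assms(1) and F = assms(2) and \<tau> = assms(7) and \<eta>\<^sub>0 = assms(8) and K = assms(9)
    and entropy_le = assms(10)
  interpret P: prob_space P by fact
  interpret Q: prob_space Q by fact
  have "subalgebra M (stopped_algebra M T F \<tau>)"
    by (rule subalgebra_stopped_algebra[OF F \<tau>])
  then have \<tau>M: "\<tau> \<in> borel_measurable M"
    using ext_stopping_time_measurable[OF T F \<tau>] by (rule measurable_from_subalg)
  have \<tau>P[measurable]: "\<tau> \<in> borel_measurable P" and \<tau>Q[measurable]: "\<tau> \<in> borel_measurable Q"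
    using \<tau>M measurable_cong_sets[OF assms(4) refl] measurable_cong_sets[OF assms(6) refl] by auto
  define X where "X n \<omega> = enn2real (min (\<tau> \<omega>) (of_nat n))" for n \<omega>
  have X0: "0 \<le> X n \<omega>" and Xn: "X n \<omega> \<le> real n" for n \<omega>
    by (auto simp: X_def enn2real_min_of_nat_le)
  have [measurable]: "X n \<in> borel_measurable P" "X n \<in> borel_measurable Q" for n
    unfolding X_def by measurable
  define a where "a n = (\<integral>\<omega>. X n \<omega> \<partial>Q)" for n
  have a: "(\<integral>\<^sup>+\<omega>. min (\<tau> \<omega>) (of_nat n) \<partial>Q) = ennreal (a n)" and a0: "0 \<le> a n" for n
  proof -
    have "integrable Q (X n)"
      using X0 Xn by (intro Q.integrable_const_bound[where B = "real n"]) auto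
    from nn_integral_eq_integral[OF this]
    show "(\<integral>\<^sup>+\<omega>. min (\<tau> \<omega>) (of_nat n) \<partial>Q) = ennreal (a n)"
      using X0 by (simp add: a_def enn2real_min_of_nat X_def[abs_def])
    show "0 \<le> a n" using X0 by (simp add: a_def)
  qed
  define Z where "Z c n = (\<integral>\<omega>. exp (c * X n \<omega>) \<partial>P)" for c n
  have intZ: "integrable P (\<lambda>\<omega>. exp (c * X n \<omega>))" for c n
  proof (rule P.integrable_const_bound[where B = "exp (\<bar>c\<bar> * n)"])
    have "c * X n \<omega> \<le> \<bar>c\<bar> * real n" for \<omega>
      using X0[of n \<omega>] Xn[of n \<omega>] by (intro mult_mono) auto
    then show "AE \<omega> in P. norm (exp (c * X n \<omega>)) \<le> exp (\<bar>c\<bar> * real n)" by auto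
  qed auto
  have Z0: "0 < Z c n" for c n
    unfolding Z_def using P.integral_less_AE_space[OF _ intZ[of c n], of "\<lambda>_. 0"]
    by (simp add: P.emeasure_space_1)
  \<comment> \<open>the variational inequality for \<open>c X\<^sub>n\<close> on the sigma-algebra of \<open>min \<tau> n\<close>\<close>
  have key: "c * a n - ln (Z c n) \<le> \<eta>\<^sub>0 + K * a n" if n: "0 < n" for c n
  proof -
    let ?\<sigma> = "\<lambda>\<omega>. min (\<tau> \<omega>) (of_nat n)"
    let ?G = "stopped_algebra M T F ?\<sigma>"
    have "real n \<in> T" using T by auto
    from ext_stopping_time_min[OF F \<tau> this]
    have \<sigma>: "ext_stopping_time M T F ?\<sigma>" by (simp add: ennreal_of_nat_eq_real_of_nat)
    have sub: "subalgebra P ?G" "subalgebra Q ?G"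
      using subalgebra_stopped_algebra[OF F \<sigma>] assms(4,6) sets_eq_imp_space_eq[OF assms(4)]
        sets_eq_imp_space_eq[OF assms(6)] by (auto simp: subalgebra_def)
    have [measurable]: "?\<sigma> \<in> borel_measurable ?G"
      by (rule ext_stopping_time_measurable[OF T F \<sigma>])
    have "ereal ((\<integral>\<omega>. c * X n \<omega> \<partial>Q) - ln (\<integral>\<omega>. exp (c * X n \<omega>) \<partial>P))
        \<le> relative_entropy (restr_to_subalg Q ?G) (restr_to_subalg P ?G)"
    proof (rule gibbs_variational_le_relative_entropy_restr[OF assms(3,5) sub])
      show "(\<lambda>\<omega>. c * X n \<omega>) \<in> borel_measurable ?G" unfolding X_def by measurable
      show "\<bar>c * X n \<omega>\<bar> \<le> \<bar>c\<bar> * real n" for \<omega>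
        using X0[of n \<omega>] Xn[of n \<omega>] by (simp add: abs_mult mult_left_mono)
    qed
    also have "\<dots> \<le> ereal \<eta>\<^sub>0 + ereal K * enn2ereal (\<integral>\<^sup>+\<omega>. min (\<tau> \<omega>) (of_nat n) \<partial>Q)"
      by (rule entropy_le[OF n])
    finally show ?thesis using a0 by (simp add: a a_def Z_def)
  qed
  show ?thesis
  proof
    have "- enn2ereal (\<integral>\<^sup>+\<omega>. \<tau> \<omega> \<partial>Q) \<le> ereal (inverse (c + K)) * (cumulant P \<tau> (- c) + ereal \<eta>\<^sub>0)"
      if "0 < c" for c
    proof (cases "\<integral>\<^sup>+\<omega>. \<tau> \<omega> \<partial>Q")
      case (real e)
      \<comment> \<open>A finite mean \<open>e\<close> bounds \<open>Z (- c) n\<close> away from \<open>0\<close> uniformly in \<open>n\<close>, so the limit is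
        taken before the logarithm and its discontinuity at \<open>0\<close> causes no trouble.\<close>
      have cK: "0 < c + K" using that K by simp
      have "exp (- (c + K) * e - \<eta>\<^sub>0) \<le> Z (- c) n" if n: "0 < n" for n
      proof -
        have "ennreal (a n) \<le> ennreal e"
          unfolding a[symmetric] real(2)[symmetric] by (intro nn_integral_mono) auto
        then have "(c + K) * a n \<le> (c + K) * e"
          using real(1) cK by (intro mult_left_mono) (auto simp: ennreal_le_iff)
        then have "- (c + K) * e - \<eta>\<^sub>0 \<le> ln (Z (- c) n)"
          using key[OF n, of "- c"] by (simp add: algebra_simps)
        then show ?thesis using Z0 by (simp add: ln_ge_iff)
      qed
      then have "ennreal (exp (- (c + K) * e - \<eta>\<^sub>0)) \<le>
          (\<integral>\<^sup>+\<omega>. exp_ext (ereal (- c) * enn2ereal (\<tau> \<omega>)) \<partial>P)"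
        using assms(3) \<tau>P \<open>0 < c\<close>
        by (intro exp_ext_nn_integral_ge_of_truncations) (auto simp: Z_def X_def)
      from ln_ext_mono[OF this]
      have le: "ereal (- (c + K) * e - \<eta>\<^sub>0) \<le> cumulant P \<tau> (- c)"
        by (simp add: cumulant_def ln_ext_ennreal)
      have "ereal (- e) \<le> ereal (inverse (c + K)) * (cumulant P \<tau> (- c) + ereal \<eta>\<^sub>0)"
        using le cK by (cases "cumulant P \<tau> (- c)") (auto simp: field_simps)
      then show ?thesis using real by simp
    qed simp
    then show "- (INF c\<in>{0<..}. ereal (inverse (c + K)) * (cumulant P \<tau> (- c) + ereal \<eta>\<^sub>0))
        \<le> enn2ereal (\<integral>\<^sup>+\<omega>. \<tau> \<omega> \<partial>Q)"
      by (subst ereal_uminus_le_reorder) (auto intro!: INF_greatest)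
  next
    have "enn2ereal (\<integral>\<^sup>+\<omega>. \<tau> \<omega> \<partial>Q) \<le> ereal (inverse (l - K)) * (cumulant P \<tau> l + ereal \<eta>\<^sub>0)"
      if l: "K < l" for l
    proof -
      have "ereal (a n) \<le> ereal (inverse (l - K)) * (cumulant P \<tau> l + ereal \<eta>\<^sub>0)" if n: "0 < n" for n
      proof -
        have "ennreal (Z l n) = (\<integral>\<^sup>+\<omega>. ennreal (exp (l * X n \<omega>)) \<partial>P)"
          using intZ by (simp add: Z_def nn_integral_eq_integral)
        also have "\<dots> \<le> (\<integral>\<^sup>+\<omega>. exp_ext (ereal l * enn2ereal (\<tau> \<omega>)) \<partial>P)"
          unfolding X_def using l K by (intro nn_integral_mono exp_truncation_le_exp_ext) auto
        finally have "ereal (ln (Z l n)) \<le> cumulant P \<tau> l"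
          using ln_ext_mono Z0[of l n] by (metis cumulant_def ln_ext_ennreal)
        moreover have "(l - K) * a n \<le> ln (Z l n) + \<eta>\<^sub>0"
          using key[OF n, of l] by (simp add: algebra_simps)
        ultimately show ?thesis
          using l by (cases "cumulant P \<tau> l") (auto simp: field_simps)
      qed
      then have le: "ereal (a n) \<le> ereal (inverse (l - K)) * (cumulant P \<tau> l + ereal \<eta>\<^sub>0)" (is "_ \<le> ?b")
        if "0 < n" for n using that .
      have "0 \<le> ?b" using le[of 1] a0[of 1] by (meson ereal_less_eq(5) order_trans zero_less_one)
      have "(\<integral>\<^sup>+\<omega>. \<tau> \<omega> \<partial>Q) \<le> e2ennreal ?b"
      proof (rule nn_integral_le_of_truncations[OF \<tau>Q])
        fix n :: nat assume "0 < n"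
        from e2ennreal_mono[OF le[OF this]]
        show "(\<integral>\<^sup>+\<omega>. min (\<tau> \<omega>) (of_nat n) \<partial>Q) \<le> e2ennreal ?b"
          by (simp add: a a0 e2ennreal_ereal)
      qed
      then show ?thesis
        using \<open>0 \<le> ?b\<close> by (simp add: less_eq_ennreal.rep_eq enn2ereal_e2ennreal)
    qed
    then show "enn2ereal (\<integral>\<^sup>+\<omega>. \<tau> \<omega> \<partial>Q)
        \<le> (INF l\<in>{K<..}. ereal (inverse (l - K)) * (cumulant P \<tau> l + ereal \<eta>\<^sub>0))"
      by (auto intro!: INF_greatest)
  qed
qed

end
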